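(* Let $f:\mathbb{R}^n\to\mathbb{R}\cup\{\infty\}$ be convex and let $X\subset\operatorname{int}(\operatorname{dom} f)$ be closed and convex with $X^*=\operatorname{argmin}\{f(x)\mid x\in X\}\neq\emptyset$. Let $(\varepsilon_k)_{k\ge 0}$ satisfy $$\varepsilon_k\ge 0 \text{ for all } k,\qquad \sum_{k=0}^\infty\varepsilon_k<\infty,$$ let $(\alpha_k)_{k\ge 0}$ be a positive sequence with $$\sum_{k=0}^\infty\alpha_k=\infty,\qquad \sum_{k=0}^\infty\alpha_k^2<\infty,$$ and suppose that $$\alpha_k\ \ge\ \sum_{j=k}^\infty\varepsilon_j\qquad\text{for all } k=0,1,2,\dots$$ Let $(x^k)$ be the sequence generated from a starting point $x^0$ by $$x^{k+1}=\mathcal{P}_X^{\varepsilon_k}\big(x^k-\alpha_k h^k\big),\qquad h^k\in\partial f(x^k)\ \text{arbitrary},\qquad k=0,1,2,\dots,$$ and suppose that there is a constant $H<\infty$ with $\|h^k\|\le H$ for all $k$. Then the sequence $(x^k)$ converges to an optimal point, i.e., to some point of $X^*$.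
   Context: $\|\cdot\|$ is the Euclidean norm on $\mathbb{R}^n$. $\operatorname{dom} f=\{x\in\mathbb{R}^n\mid f(x)<\infty\}$, and $X$ is strictly contained in $\operatorname{int}(\operatorname{dom} f)$. The subdifferential is $\partial f(x)=\{h\in\mathbb{R}^n\mid f(y)\ge f(x)+h^\top(y-x)\ \forall y\in\mathbb{R}^n\}$. $\mathcal{P}_X$ is the Euclidean (orthogonal) projection onto $X$. For every $\varepsilon\ge0$, $\mathcal{P}_X^{\varepsilon}:\mathbb{R}^n\to\mathbb{R}^n$ is a map (an adaptive approximate projection) of which one assumes only that $\|\mathcal{P}_X^{\varepsilon}(x)-\mathcal{P}_X(x)\|\le\varepsilon$ for all $x\in\mathbb{R}^n$; in particular the iterates $x^k$ need not lie in $X$. It is assumed throughout that every iterate $x^k$ lies in $\operatorname{dom} f$ and that a subgradient $h^k\in\partial f(x^k)$ is available. Stopping criteria are ignored, so the sequence is infinite. *)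

theory Defs
  imports "HOL-Analysis.Analysis"
begin

text \<open>
  Functions with values in \<open>\<real> \<union> {\<infinity>}\<close> are rendered as maps into \<^typ>\<open>ereal\<close> that never take the
  value \<open>-\<infinity>\<close>; this is a separate hypothesis wherever it is needed. Convexity and the
  subdifferential as defined below are only meaningful for such functions.
\<close>

text \<open>
  The library constant \<^const>\<open>convex_on\<close> only covers real-valued functions. In \<^typ>\<open>ereal\<close> one has
  \<open>0 * \<infinity> = 0\<close>, so the inequality is trivial at the end points \<open>u = 0\<close> and \<open>v = 0\<close>, as it should be.
\<close>

definition ext_convex :: "(real ^ 'n \<Rightarrow> ereal) \<Rightarrow> bool" where
  "ext_convex f \<longleftrightarrow>
    (\<forall>x y. \<forall>u\<ge>0. \<forall>v\<ge>0. u + v = 1 \<longrightarrow>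
      f (u *\<^sub>R x + v *\<^sub>R y) \<le> ereal u * f x + ereal v * f y)"

definition eff_dom :: "(real ^ 'n \<Rightarrow> ereal) \<Rightarrow> (real ^ 'n) set" where
  "eff_dom f = {x. f x < \<infinity>}"

definition subdifferential :: "(real ^ 'n \<Rightarrow> ereal) \<Rightarrow> real ^ 'n \<Rightarrow> (real ^ 'n) set" where
  "subdifferential f x = {h. \<forall>y. f y \<ge> f x + ereal (h \<bullet> (y - x))}"

definition argmin_set :: "('a \<Rightarrow> 'b::linorder) \<Rightarrow> 'a set \<Rightarrow> 'a set" where
  "argmin_set f X = {x. is_arg_min f (\<lambda>y. y \<in> X) x}"

text \<open>
  A family of approximate projections, indexed by the accuracy \<open>\<epsilon>\<close>. The values need not lie
  in \<open>X\<close>. The set \<open>X\<close> is meant to be closed, convex and nonempty: then \<^const>\<open>closest_point\<close> is the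
  Euclidean projection (otherwise it is an arbitrary choice).
\<close>

definition approx_projection ::
    "(real ^ 'n) set \<Rightarrow> (real \<Rightarrow> real ^ 'n \<Rightarrow> real ^ 'n) \<Rightarrow> bool" where
  "approx_projection X P \<longleftrightarrow> (\<forall>\<epsilon>\<ge>0. \<forall>x. norm (P \<epsilon> x - closest_point X x) \<le> \<epsilon>)"

end

theory Submission
  imports Defs
begin

text \<open>
  For an optimal point \<open>z\<close>, an upper bound of \<open>f\<close> on a ball around \<open>z\<close> and convexity yield a
  constant \<open>L\<close> with \<open>f x \<ge> f z - L * dist x y\<close> for all \<open>x \<in> dom f\<close> and all \<open>y \<in> X\<close>; hence an
  infeasible iterate undercuts the optimal value by at most \<open>L\<close> times the previous projection
  accuracy. So the squared distances \<open>a\<^sub>k\<close> of the iterates to \<open>z\<close> satisfy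
  \<open>a\<^sub>k\<^sub>+\<^sub>1 \<le> (1 + \<epsilon>\<^sub>k) a\<^sub>k + c\<^sub>k - d\<^sub>k\<close> with \<open>c\<close> summable and \<open>d\<^sub>k \<ge> 0\<close> essentially
  \<open>2 \<alpha>\<^sub>k (f x\<^sub>k - f z)\<close>. A deterministic Robbins-Siegmund argument makes \<open>a\<close> convergent and \<open>d\<close>
  summable. As \<open>\<Sum> \<alpha>\<^sub>k\<close> diverges, some subsequence of the iterates converges to an optimal point,
  and with this point as \<open>z\<close> the convergent sequence \<open>a\<close> must tend to 0.
\<close>

text \<open>The partial products \<open>p\<close> of the factors \<open>1 + b j\<close> stay between
  1 and \<open>exp (suminf b)\<close>. Dividing the recursion by \<open>p (Suc k)\<close> therefore
  absorbs these factors at the cost of bounded constants, leaving an additive recursion for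
  \<open>u\<close>.\<close>

lemma robbins_siegmund:
  fixes a b c d :: "nat \<Rightarrow> real"
  assumes a: "\<And>k. a k \<ge> 0" and b: "\<And>k. b k \<ge> 0" and c: "\<And>k. c k \<ge> 0" and d: "\<And>k. d k \<ge> 0"
    and step: "\<And>k. a (Suc k) \<le> (1 + b k) * a k + c k - d k"
    and sb: "summable b" and sc: "summable c"
  shows "convergent a" and "summable d"
proof -
  define p where "p k = (\<Prod>j<k. 1 + b j)" for k
  have p1: "p k \<ge> 1" for k
    unfolding p_def by (rule prod_ge_1) (use b in simp)
  have ppos: "p k > 0" for k using p1[of k] by linarith
  have pS: "p (Suc k) = p k * (1 + b k)" for k by (simp add: p_def)
  have pB: "p k \<le> exp (suminf b)" for k
  proof -
    have "p k \<le> (\<Prod>j<k. exp (b j))"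
      unfolding p_def by (rule prod_mono) (use b in \<open>auto intro: add_nonneg_nonneg exp_ge_add_one_self\<close>)
    also have "\<dots> = exp (\<Sum>j<k. b j)" by (simp add: exp_sum)
    also have "\<dots> \<le> exp (suminf b)" using sum_le_suminf[OF sb, of "{..<k}"] b by auto
    finally show ?thesis .
  qed
  have "incseq p"
  proof (rule incseq_SucI)
    fix k show "p k \<le> p (Suc k)"
      unfolding pS using mult_left_mono[of 1 "1 + b k" "p k"] ppos[of k] b[of k] by simp
  qed
  then obtain q where q: "p \<longlonglongrightarrow> q" using incseq_convergent pB by blast
  define c' where "c' k = c k / p (Suc k)" for k
  define d' where "d' k = d k / p (Suc k)" for k
  have c'0: "c' k \<ge> 0" and d'0: "d' k \<ge> 0" for k
    using c d ppos by (auto simp: c'_def d'_def less_imp_le)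
  have c'le: "c' k \<le> c k" for k
    unfolding c'_def using c[of k] p1[of "Suc k"] divide_left_mono[of 1 "p (Suc k)" "c k"] by simp
  have sc': "summable c'"
    by (rule summable_comparison_test'[OF sc, of 0]) (use c'0 c'le in simp)
  define u where "u k = a k / p k" for k
  have u0: "u k \<ge> 0" for k using a ppos by (simp add: u_def less_imp_le)
  have uS: "u (Suc k) \<le> u k + c' k - d' k" for k
  proof -
    have "u (Suc k) \<le> ((1 + b k) * a k + c k - d k) / p (Suc k)"
      unfolding u_def using step ppos[of "Suc k"] by (simp add: divide_right_mono)
    also have "\<dots> = (1 + b k) * a k / p (Suc k) + c' k - d' k"
      by (simp add: add_divide_distrib diff_divide_distrib c'_def d'_def)
    also have "(1 + b k) * a k / p (Suc k) = u k"
      unfolding pS u_def using b[of k] by (simp add: mult.commute[of "1 + b k"])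
    finally show ?thesis .
  qed
  have c'sum: "(\<Sum>j<k. c' j) \<le> suminf c'" for k
    using sum_le_suminf[OF sc', of "{..<k}"] c'0 by auto
  \<comment> \<open>The terms \<open>c'\<close> are all that can make \<open>u\<close> increase.
    Subtracting their partial sums leaves a decreasing sequence, bounded below because
    \<open>u\<close> is nonnegative and \<open>c'\<close> is summable; adding them back and
    multiplying by \<open>p\<close> recovers \<open>a\<close>.\<close>
  have "decseq (\<lambda>k. u k - (\<Sum>j<k. c' j))"
    by (rule decseq_SucI) (use uS d'0 in \<open>simp add: algebra_simps\<close>, smt (verit))
  moreover have "- suminf c' \<le> u k - (\<Sum>j<k. c' j)" for k
    using u0[of k] c'sum[of k] by linarith
  ultimately obtain l where l: "(\<lambda>k. u k - (\<Sum>j<k. c' j)) \<longlonglongrightarrow> l"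
    using decseq_convergent by blast
  have "(\<lambda>k. (u k - (\<Sum>j<k. c' j) + (\<Sum>j<k. c' j)) * p k) \<longlonglongrightarrow> (l + suminf c') * q"
    by (intro tendsto_intros l q summable_LIMSEQ sc')
  moreover have "(u k - (\<Sum>j<k. c' j) + (\<Sum>j<k. c' j)) * p k = a k" for k
    using ppos[of k] by (simp add: u_def)
  ultimately show "convergent a" by (auto simp: convergent_def)
  have d'sum: "(\<Sum>j<k. d' j) \<le> u 0 + (\<Sum>j<k. c' j) - u k" for k
  proof (induction k)
    case (Suc k)
    then show ?case using uS[of k] by simp
  qed simp
  have "summable d'"
  proof (rule summableI_nonneg_bounded[OF d'0])
    show "(\<Sum>j<k. d' j) \<le> u 0 + suminf c'" for k
      using d'sum[of k] c'sum[of k] u0[of k] by linarith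
  qed
  then have "summable (\<lambda>k. exp (suminf b) * d' k)" by (rule summable_mult)
  then show "summable d"
  proof (rule summable_comparison_test'[where N = 0])
    fix k
    have "d k = p (Suc k) * d' k" using ppos[of "Suc k"] by (simp add: d'_def)
    also have "\<dots> \<le> exp (suminf b) * d' k" using pB d'0 by (intro mult_right_mono)
    finally show "norm (d k) \<le> exp (suminf b) * d' k" using d by simp
  qed
qed

lemma ext_convex_convex_on:
  assumes "\<And>y. f y \<noteq> -\<infinity>" and "ext_convex f"
  shows "convex_on (eff_dom f) (\<lambda>y. real_of_ereal (f y))"
proof -
  have F: "f y = ereal (real_of_ereal (f y))" if "y \<in> eff_dom f" for y
    using that assms(1)[of y] by (cases "f y") (auto simp: eff_dom_def)
  have le: "f (u *\<^sub>R x + v *\<^sub>R y) \<le> ereal (u * real_of_ereal (f x) + v * real_of_ereal (f y))"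
    if "x \<in> eff_dom f" "y \<in> eff_dom f" "u \<ge> 0" "v \<ge> 0" "u + v = 1" for x y and u v :: real
  proof -
    have "f (u *\<^sub>R x + v *\<^sub>R y) \<le> ereal u * f x + ereal v * f y"
      using assms(2) that unfolding ext_convex_def by blast
    then show ?thesis by (subst (asm) F[OF that(1)], subst (asm) F[OF that(2)]) simp
  qed
  have "u *\<^sub>R x + v *\<^sub>R y \<in> eff_dom f"
    if "x \<in> eff_dom f" "y \<in> eff_dom f" "u \<ge> 0" "v \<ge> 0" "u + v = 1" for x y and u v :: real
    using le[OF that] by (auto simp: eff_dom_def intro: le_less_trans)
  then have cvx: "convex (eff_dom f)" by (auto simp: convex_def)
  show ?thesis
  proof (rule convex_onI)
    fix t :: real and x y assume t: "0 < t" "t < 1" and xy: "x \<in> eff_dom f" "y \<in> eff_dom f"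
    have in_dom: "(1 - t) *\<^sub>R x + t *\<^sub>R y \<in> eff_dom f"
      using cvx xy t by (simp add: convexD_alt)
    have "f ((1 - t) *\<^sub>R x + t *\<^sub>R y) \<le> ereal ((1 - t) * real_of_ereal (f x) + t * real_of_ereal (f y))"
      using le[OF xy, of "1 - t" t] t by simp
    then show "real_of_ereal (f ((1 - t) *\<^sub>R x + t *\<^sub>R y))
        \<le> (1 - t) * real_of_ereal (f x) + t * real_of_ereal (f y)"
      by (subst (asm) F[OF in_dom]) simp
  qed (rule cvx)
qed

text \<open>Minimality of \<open>z\<close> says nothing directly about points outside
  \<open>X\<close>. If \<open>F x\<close> were too small, the bound \<open>M\<close> on a ball of
  radius \<open>r\<close> around \<open>z\<close> and convexity along the segment from
  \<open>x\<close> to a point \<open>w\<close> of that ball would push \<open>F\<close> below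
  \<open>F z\<close> at a point of \<open>X\<close>. The constant \<open>(M - F z) / r\<close>
  depends on neither \<open>x\<close> nor \<open>y\<close>.\<close>

lemma convex_minimum_lower_bound:
  fixes F :: "'a::euclidean_space \<Rightarrow> real"
  assumes F: "convex_on D F" and X: "convex X" "X \<subseteq> D"
    and z: "z \<in> X" "z \<in> interior D" and min: "\<And>y. y \<in> X \<Longrightarrow> F z \<le> F y"
  obtains L where "L \<ge> 0" and "\<And>x y. x \<in> D \<Longrightarrow> y \<in> X \<Longrightarrow> F z - L * dist x y \<le> F x"
proof -
  have "continuous_on (interior D) F"
    using convex_on_subset[OF F interior_subset] convex_interior[OF convex_on_imp_convex[OF F]]
    by (intro convex_on_continuous) auto
  obtain r where r: "r > 0" "cball z r \<subseteq> interior D"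
    using z(2) open_contains_cball[of "interior D"] by auto
  have "compact (F ` cball z r)"
    using \<open>continuous_on (interior D) F\<close> r(2)
    by (intro compact_continuous_image) (auto intro: continuous_on_subset)
  then obtain M where M: "\<And>w. w \<in> cball z r \<Longrightarrow> F w \<le> M"
    using compact_imp_bounded bounded_has_Sup(1)[of "F ` cball z r"] r(1)
    by (metis centre_in_cball empty_iff imageI less_imp_le)
  have MF: "F z \<le> M" using M r(1) by simp
  show thesis
  proof (rule that[of "(M - F z) / r"])
    show "(M - F z) / r \<ge> 0" using MF r(1) by simp
  next
    fix x y assume x: "x \<in> D" and y: "y \<in> X"
    show "F z - (M - F z) / r * dist x y \<le> F x"
    proof (cases "x = y")
      case True then show ?thesis using min[OF y] by simp
    next
      case False
      \<comment> \<open>The point \<open>s *\<^sub>R y + (1 - s) *\<^sub>R z\<close> of \<open>X\<close> is also a convex combination of \<open>x\<close> and \<open>w\<close>.\<close>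
      define e where "e = dist x y"
      have e: "e > 0" using False by (simp add: e_def)
      define w where "w = z + (r / e) *\<^sub>R (y - x)"
      \<comment> \<open>This weight satisfies \<open>(1 - s) * (r / e) = s\<close>, so the
        displacement of \<open>w\<close> from \<open>z\<close> exactly compensates for replacing
        \<open>y\<close> by \<open>x\<close>.\<close>
      define s where "s = r / (r + e)"
      have s: "0 < s" "s < 1" and s1: "1 - s = e / (r + e)"
        using r(1) e by (auto simp: s_def field_simps)
      have "dist z w = r"
        using r(1) e by (simp add: w_def dist_norm e_def norm_minus_commute)
      then have w: "w \<in> cball z r" by simp
      then have wD: "w \<in> D" using r(2) interior_subset by blast
      have "(1 - s) * (r / e) = s" unfolding s1 using e r(1) by (simp add: s_def)
      then have eq: "s *\<^sub>R x + (1 - s) *\<^sub>R w = s *\<^sub>R y + (1 - s) *\<^sub>R z"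
        by (simp add: w_def scaleR_add_right scaleR_diff_right)
      have "s *\<^sub>R y + (1 - s) *\<^sub>R z \<in> X"
        using X(1) y z(1) s by (intro convexD) auto
      then have "F z \<le> F (s *\<^sub>R x + (1 - s) *\<^sub>R w)" using min eq by simp
      also have "\<dots> \<le> s * F x + (1 - s) * F w"
        using F x wD s unfolding convex_on_def by simp
      also have "\<dots> \<le> s * F x + (1 - s) * M"
        using M[OF w] s by simp
      finally have "F z \<le> (r * F x + e * M) / (r + e)"
        unfolding s1 unfolding s_def by (simp add: add_divide_distrib)
      then have "r * F z + e * F z \<le> r * F x + e * M"
        using e r(1) by (simp add: pos_le_divide_eq algebra_simps)
      then show ?thesis using r(1) by (simp add: e_def[symmetric] field_simps)
    qed
  qed
qed

text \<open>The projection is nonexpansive and fixes \<open>z\<close>, so \<open>w\<close> is within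
  \<open>e + norm (u - z)\<close> of \<open>z\<close>. Bounding the cross term by
  \<open>2 * n \<le> 1 + n\<^sup>2\<close> moves it into the factor \<open>1 + e\<close>, so no
  prior bound on the iterates is required.\<close>

lemma approx_projection_step:
  assumes X: "closed X" "convex X" and z: "z \<in> X" and w: "norm (w - closest_point X u) \<le> e"
  shows "(norm (w - z))\<^sup>2 \<le> (1 + e) * (norm (u - z))\<^sup>2 + (e + e\<^sup>2)"
proof -
  let ?n = "norm (u - z)"
  have e: "e \<ge> 0" using w norm_ge_zero order_trans by blast
  have "norm (closest_point X u - z) \<le> ?n"
    using closest_point_lipschitz[OF X(2,1), of u z] z by (auto simp: closest_point_self dist_norm)
  then have "norm (w - z) \<le> e + ?n"
    using w norm_triangle_ineq[of "w - closest_point X u" "closest_point X u - z"] by simp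
  then have "(norm (w - z))\<^sup>2 \<le> (e + ?n)\<^sup>2" by (simp add: power_mono)
  also have "\<dots> = ?n\<^sup>2 + e * (2 * ?n) + e\<^sup>2" by (simp add: power2_eq_square algebra_simps)
  also have "e * (2 * ?n) \<le> e * (1 + ?n\<^sup>2)"
    using e sum_squares_bound[of 1 ?n] by (intro mult_left_mono) auto
  finally show ?thesis by (simp add: algebra_simps)
qed

text \<open>If \<open>g\<close> stayed above a positive constant from some index on,
  \<open>w\<close> would be dominated by a multiple of the summable \<open>w k * g k\<close>. The
  indices need only satisfy \<open>r n \<ge> n\<close>; \<open>r\<close> may repeat values.\<close>

lemma divergent_weights_subsequence:
  fixes w g :: "nat \<Rightarrow> real"
  assumes w: "\<And>k. w k \<ge> 0" "\<not> summable w" and wg: "summable (\<lambda>k. w k * g k)"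
  obtains r where "filterlim r at_top sequentially"
    and "\<And>n. g (r n) < inverse (real (Suc n))"
proof -
  have "\<exists>k\<ge>n. g k < inverse (real (Suc n))" for n
  proof (rule ccontr)
    assume "\<not> ?thesis"
    then have g: "inverse (real (Suc n)) \<le> g k" if "k \<ge> n" for k using that by force
    have "summable (\<lambda>k. real (Suc n) * (w k * g k))" using wg by (rule summable_mult)
    then have "summable w"
    proof (rule summable_comparison_test'[where N = n])
      fix k assume "k \<ge> n"
      then have "1 \<le> real (Suc n) * g k"
        using mult_left_mono[OF g, of k "real (Suc n)"] by simp
      from mult_left_mono[OF this w(1)[of k]]
      show "norm (w k) \<le> real (Suc n) * (w k * g k)" using w(1)[of k] by (simp add: mult_ac)
    qed
    with w(2) show False ..
  qed
  then obtain r where r: "\<And>n. r n \<ge> n" "\<And>n. g (r n) < inverse (real (Suc n))" by metis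
  have "filterlim r at_top sequentially"
    by (rule filterlim_at_top_mono[OF filterlim_ident]) (use r in simp)
  with r(2) show thesis using that by blast
qed

theorem theorem1:
  fixes f :: "real ^ 'n \<Rightarrow> ereal"
    and X :: "(real ^ 'n) set"
    and P :: "real \<Rightarrow> real ^ 'n \<Rightarrow> real ^ 'n"
    and \<epsilon> \<alpha> :: "nat \<Rightarrow> real"
    and x h :: "nat \<Rightarrow> real ^ 'n"
    and H :: real
  assumes "\<And>y. f y \<noteq> -\<infinity>"
    and "ext_convex f"
    and "closed X" and "convex X"
    and "X \<subset> interior (eff_dom f)"
    and "argmin_set f X \<noteq> {}"
    and "approx_projection X P"
    and "\<And>k. \<epsilon> k \<ge> 0" and "summable \<epsilon>"
    and "\<And>k. \<alpha> k > 0"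
    and "filterlim (\<lambda>n. \<Sum>k<n. \<alpha> k) at_top sequentially"
    and "summable (\<lambda>k. (\<alpha> k)\<^sup>2)"
    and "\<And>k. \<alpha> k \<ge> (\<Sum>j. \<epsilon> (k + j))"
    and "\<And>k. x k \<in> eff_dom f"
    and "\<And>k. h k \<in> subdifferential f (x k)"
    and "\<And>k. x (Suc k) = P (\<epsilon> k) (x k - \<alpha> k *\<^sub>R h k)"
    and "\<And>k. norm (h k) \<le> H"
  shows "\<exists>z \<in> argmin_set f X. x \<longlonglongrightarrow> z"
proof -
  note f_fin = assms(1) and f_convex = assms(2) and X = assms(3,4) and X_dom = assms(5)
    and ex_min = assms(6) and P = assms(7) and eps0 = assms(8) and eps_sum = assms(9)
    and alpha0 = assms(10) and alpha_div = assms(11) and alpha_sq = assms(12)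
    and x_dom = assms(14) and h_sub = assms(15) and x_step = assms(16) and h_bound = assms(17)
  define F where "F y = real_of_ereal (f y)" for y
  let ?D = "eff_dom f"
  have fF: "f y = ereal (F y)" if "y \<in> ?D" for y
    using that f_fin[of y] unfolding F_def by (cases "f y") (auto simp: eff_dom_def)
  have F_convex: "convex_on ?D F"
    using ext_convex_convex_on[OF f_fin f_convex] by (simp add: F_def[abs_def])
  have XI: "X \<subseteq> interior ?D" using X_dom by blast
  then have XD: "X \<subseteq> ?D" using interior_subset by blast
  have argmin_iff: "z \<in> argmin_set f X \<longleftrightarrow> z \<in> X \<and> (\<forall>y\<in>X. F z \<le> F y)" for z
    using XD fF by (auto simp: argmin_set_def is_arg_min_linorder subset_iff)
  have F_cont: "continuous_on (interior ?D) F"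
    using convex_on_subset[OF F_convex interior_subset]
      convex_interior[OF convex_on_imp_convex[OF F_convex]]
    by (intro convex_on_continuous) auto

  define y where "y k = closest_point X (x k - \<alpha> k *\<^sub>R h k)" for k
  have "X \<noteq> {}" using ex_min argmin_iff by blast
  then have yX: "y k \<in> X" for k unfolding y_def using X by (intro closest_point_in_set)
  have xy: "norm (x (Suc k) - y k) \<le> \<epsilon> k" for k
    using P eps0 unfolding approx_projection_def x_step y_def by blast
  have eps_lim: "\<epsilon> \<longlonglongrightarrow> 0" using eps_sum by (rule summable_LIMSEQ_zero)

  \<comment> \<open>Square summability sends the step sizes to 0. This yields the uniform bound
    \<open>A\<close> that later multiplies the infeasibility error.\<close>
  have "(\<lambda>k. sqrt ((\<alpha> k)\<^sup>2)) \<longlonglongrightarrow> sqrt 0"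
    by (intro tendsto_real_sqrt summable_LIMSEQ_zero alpha_sq)
  then have alpha_lim: "\<alpha> \<longlonglongrightarrow> 0" using alpha0 by (simp add: less_imp_le)
  then obtain A where A: "\<And>k. \<alpha> k \<le> A"
    using convergent_imp_Bseq[of \<alpha>] by (auto simp: convergent_def Bseq_def abs_le_iff)
  have "\<not> summable \<alpha>"
  proof
    assume "summable \<alpha>"
    then have "(\<lambda>n. \<Sum>k<n. \<alpha> k) \<longlonglongrightarrow> suminf \<alpha>" by (rule summable_LIMSEQ)
    with alpha_div show False
      using not_tendsto_and_filterlim_at_infinity[of sequentially]
      by (metis filterlim_at_top_imp_at_infinity sequentially_bot)
  qed
  then have alpha_div': "\<not> summable (\<lambda>k. \<alpha> (Suc k))" by (simp add: summable_Suc_iff)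
  obtain E where E: "\<And>k. \<epsilon> k \<le> E"
    using eps_lim convergent_imp_Bseq[of \<epsilon>] by (auto simp: convergent_def Bseq_def abs_le_iff)
  have E0: "E \<ge> 0" using E[of 0] eps0[of 0] by linarith

  \<comment> \<open>The index starts at \<open>Suc k\<close> because \<open>x 0\<close> may be far
    from \<open>X\<close>, whereas \<open>x (Suc k)\<close> is within \<open>\<epsilon> k\<close> of
    \<open>y k\<close>. The claim covers every optimal \<open>z\<close> since it is used twice: for
    an arbitrary one and then for the cluster point \<open>p\<close>.\<close>
  have key: "convergent (\<lambda>k. (norm (x (Suc k) - z))\<^sup>2) \<and>
      (\<exists>L. summable (\<lambda>k. \<alpha> (Suc k) * (F (x (Suc k)) - F z + L * \<epsilon> k)))"
    if z: "z \<in> argmin_set f X" for z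
  proof -
    have zX: "z \<in> X" and zmin: "\<And>y. y \<in> X \<Longrightarrow> F z \<le> F y" using z argmin_iff by auto
    obtain L where L0: "L \<ge> 0" and L: "\<And>u v. u \<in> ?D \<Longrightarrow> v \<in> X \<Longrightarrow> F z - L * dist u v \<le> F u"
      using convex_minimum_lower_bound[OF F_convex X(2) XD zX _ zmin] zX XI by blast
    \<comment> \<open>The gap \<open>F (x (Suc k)) - F z\<close> may be negative at an infeasible
      iterate. By the lower bound with \<open>y k\<close> as the point of \<open>X\<close>, adding
      \<open>L * \<epsilon> k\<close> makes it nonnegative.\<close>
    define g where "g k = F (x (Suc k)) - F z + L * \<epsilon> k" for k
    have g0: "g k \<ge> 0" for k
      using L[OF x_dom yX, of "Suc k" k] mult_left_mono[OF xy[of k] L0]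
      by (simp add: g_def dist_norm)
    \<comment> \<open>The term with \<open>L\<close> pays for the correction inside
      \<open>g\<close>, the one with \<open>H\<close> for the squared subgradient step. The factor
      \<open>1 + E\<close> and the terms in \<open>\<epsilon> (Suc k)\<close> come from the
      approximate projection, with \<open>E * \<epsilon> (Suc k)\<close> bounding the square of the
      accuracy.\<close>
    define c where "c k = (1 + E) * (2 * A * L * \<epsilon> k + H\<^sup>2 * (\<alpha> (Suc k))\<^sup>2)
        + (\<epsilon> (Suc k) + E * \<epsilon> (Suc k))" for k
    have A0: "A \<ge> 0" using A[of 0] alpha0[of 0] by linarith
    have c0: "c k \<ge> 0" for k
      unfolding c_def using E0 A0 L0 eps0 by (intro add_nonneg_nonneg mult_nonneg_nonneg) auto
    have c_sum: "summable c"
      unfolding c_def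
      using eps_sum alpha_sq summable_Suc_iff[of \<epsilon>] summable_Suc_iff[of "\<lambda>k. (\<alpha> k)\<^sup>2"]
      by (intro summable_add summable_mult) auto
    have step: "(norm (x (Suc (Suc k)) - z))\<^sup>2
        \<le> (1 + \<epsilon> (Suc k)) * (norm (x (Suc k) - z))\<^sup>2 + c k - 2 * (\<alpha> (Suc k) * g k)" for k
    proof -
      let ?x = "x (Suc k)" and ?h = "h (Suc k)" and ?a = "\<alpha> (Suc k)" and ?e = "\<epsilon> (Suc k)"
      let ?u = "?x - ?a *\<^sub>R ?h"
      have a: "0 < ?a" "?a \<le> A" and e: "0 \<le> ?e" "?e \<le> E" using alpha0 A eps0 E by auto
      have zD: "z \<in> ?D" using zX XD by blast
      have "f z \<ge> f ?x + ereal (?h \<bullet> (z - ?x))"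
        using h_sub[of "Suc k"] by (simp add: subdifferential_def)
      then have "F ?x - F z \<le> ?h \<bullet> (?x - z)"
        unfolding fF[OF zD] fF[OF x_dom] by (simp add: inner_diff_right)
      then have hx: "?a * (F ?x - F z) \<le> ?a * (?h \<bullet> (?x - z))"
        using a by simp
      have hH: "(norm ?h)\<^sup>2 \<le> H\<^sup>2" using h_bound by (intro power_mono) auto
      have aA: "?a * (L * \<epsilon> k) \<le> A * (L * \<epsilon> k)"
        using a L0 eps0 by (intro mult_right_mono) auto
      have "(norm (?u - z))\<^sup>2 = (norm (?x - z))\<^sup>2 - 2 * (?a * (?h \<bullet> (?x - z))) + ?a\<^sup>2 * (norm ?h)\<^sup>2"
        unfolding power2_norm_eq_inner
        by (simp add: inner_diff_left inner_diff_right inner_commute power2_eq_square algebra_simps)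
      also have "\<dots> \<le> (norm (?x - z))\<^sup>2 - 2 * (?a * (F ?x - F z)) + ?a\<^sup>2 * H\<^sup>2"
        using hx mult_left_mono[OF hH, of "?a\<^sup>2"] by simp
      also have "\<dots> = (norm (?x - z))\<^sup>2 - 2 * (?a * g k) + 2 * (?a * (L * \<epsilon> k)) + ?a\<^sup>2 * H\<^sup>2"
        by (simp add: g_def algebra_simps)
      also have "\<dots> \<le> (norm (?x - z))\<^sup>2 - 2 * (?a * g k) + (2 * A * L * \<epsilon> k + H\<^sup>2 * ?a\<^sup>2)"
        using aA by (simp add: algebra_simps)
      finally have u: "(norm (?u - z))\<^sup>2
        \<le> (norm (?x - z))\<^sup>2 - 2 * (?a * g k) + (2 * A * L * \<epsilon> k + H\<^sup>2 * ?a\<^sup>2)" (is "_ \<le> _ - ?d + ?c") .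
      have "norm (x (Suc (Suc k)) - closest_point X ?u) \<le> ?e"
        using xy[of "Suc k"] by (simp add: y_def)
      then have "(norm (x (Suc (Suc k)) - z))\<^sup>2 \<le> (1 + ?e) * (norm (?u - z))\<^sup>2 + (?e + ?e\<^sup>2)"
        by (rule approx_projection_step[OF X zX])
      also have "(1 + ?e) * (norm (?u - z))\<^sup>2 \<le> (1 + ?e) * ((norm (?x - z))\<^sup>2 - ?d + ?c)"
        using u e by (intro mult_left_mono) auto
      also have "\<dots> = (1 + ?e) * (norm (?x - z))\<^sup>2 - (1 + ?e) * ?d + (1 + ?e) * ?c"
        by (simp add: algebra_simps)
      also have "(1 + ?e) * ?c \<le> (1 + E) * ?c"
        using e A0 L0 eps0 by (intro mult_right_mono add_nonneg_nonneg mult_nonneg_nonneg) auto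
      finally have "(norm (x (Suc (Suc k)) - z))\<^sup>2
        \<le> (1 + ?e) * (norm (?x - z))\<^sup>2 - (1 + ?e) * ?d + (1 + E) * ?c + (?e + ?e\<^sup>2)" by simp
      moreover have "?d \<le> (1 + ?e) * ?d"
        using mult_right_mono[of 1 "1 + ?e" ?d] e a g0[of k] by simp
      moreover have "?e\<^sup>2 \<le> E * ?e" using e by (simp add: power2_eq_square mult_right_mono)
      ultimately show ?thesis unfolding c_def by linarith
    qed
    have d0: "2 * (\<alpha> (Suc k) * g k) \<ge> 0" for k using g0 alpha0 by (simp add: less_imp_le)
    have "summable (\<lambda>k. \<epsilon> (Suc k))" using eps_sum by (simp add: summable_Suc_iff)
    note rs = robbins_siegmund[of "\<lambda>k. (norm (x (Suc k) - z))\<^sup>2" "\<lambda>k. \<epsilon> (Suc k)" c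
        "\<lambda>k. 2 * (\<alpha> (Suc k) * g k)", OF _ eps0 c0 d0 step this c_sum]
    have "summable (\<lambda>k. 2 * (\<alpha> (Suc k) * g k))" by (rule rs(2)) simp
    then have "summable (\<lambda>k. \<alpha> (Suc k) * g k)" by simp
    moreover have "convergent (\<lambda>k. (norm (x (Suc k) - z))\<^sup>2)" by (rule rs(1)) simp
    ultimately show ?thesis unfolding g_def by blast
  qed

  obtain z where z: "z \<in> argmin_set f X" using ex_min by blast
  obtain L where "summable (\<lambda>k. \<alpha> (Suc k) * (F (x (Suc k)) - F z + L * \<epsilon> k))"
    using key[OF z] by blast
  from divergent_weights_subsequence[OF _ alpha_div' this] alpha0
  obtain r where r: "filterlim r at_top sequentially"
    and Fr: "\<And>n. F (x (Suc (r n))) - F z + L * \<epsilon> (r n) < inverse (real (Suc n))"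
    by (auto simp: less_imp_le)
  have "Bseq (\<lambda>k. (norm (x (Suc k) - z))\<^sup>2)" using key[OF z] by (blast intro: convergent_imp_Bseq)
  then obtain B where B: "\<And>k. (norm (x (Suc k) - z))\<^sup>2 \<le> B" by (auto simp: Bseq_def)
  have "x (Suc k) \<in> cball z (sqrt B)" for k
    using real_le_rsqrt[OF B[of k]] by (simp add: dist_norm norm_minus_commute)
  then have "\<forall>n. x (Suc (r n)) \<in> cball z (sqrt B)" by blast
  from seq_compactE[OF compact_imp_seq_compact[OF compact_cball] this]
  obtain p s where s: "strict_mono s" and "((\<lambda>n. x (Suc (r n))) \<circ> s) \<longlonglongrightarrow> p" by blast
  then have p: "(\<lambda>n. x (Suc (r (s n)))) \<longlonglongrightarrow> p" by (simp add: comp_def)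
  have rs: "filterlim (\<lambda>n. r (s n)) at_top sequentially"
    using filterlim_compose[OF r filterlim_subseq[OF s]] .
  note eps_rs = filterlim_compose[OF eps_lim rs]
  \<comment> \<open>The iterates may all be infeasible, so closedness of \<open>X\<close> is applied
    to the exact projections \<open>y\<close>, which have the same limit because the accuracies
    vanish.\<close>
  have "(\<lambda>n. x (Suc (r (s n))) - y (r (s n))) \<longlonglongrightarrow> 0"
    by (rule Lim_null_comparison[OF _ eps_rs]) (use xy in simp)
  from tendsto_diff[OF p this] have "(\<lambda>n. y (r (s n))) \<longlonglongrightarrow> p" by simp
  then have pX: "p \<in> X" by (rule closed_sequentially[OF X(1) yX])
  have "isCont F p"
    using F_cont subsetD[OF XI pX] by (simp add: continuous_on_eq_continuous_at)
  then have Fp: "(\<lambda>n. F (x (Suc (r (s n))))) \<longlonglongrightarrow> F p" using p by (rule isCont_tendsto_compose)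
  \<comment> \<open>Along the subsequence the correction and the bound
    \<open>inverse (real (Suc (s n)))\<close> both vanish, so continuity of \<open>F\<close> at the
    interior point \<open>p\<close> leaves \<open>F p \<le> F z\<close>.\<close>
  have "F p - F z + L * 0 \<le> 0"
  proof (rule LIMSEQ_le)
    show "(\<lambda>n. F (x (Suc (r (s n)))) - F z + L * \<epsilon> (r (s n))) \<longlonglongrightarrow> F p - F z + L * 0"
      by (intro tendsto_intros Fp eps_rs)
    show "(\<lambda>n. inverse (real (Suc (s n)))) \<longlonglongrightarrow> 0"
      using filterlim_compose[OF LIMSEQ_inverse_real_of_nat filterlim_subseq[OF s]] .
    show "\<exists>N. \<forall>n\<ge>N. F (x (Suc (r (s n)))) - F z + L * \<epsilon> (r (s n)) \<le> inverse (real (Suc (s n)))"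
      using Fr less_imp_le by blast
  qed
  then have pmin: "p \<in> argmin_set f X" using z pX argmin_iff by force
  then obtain l where l: "(\<lambda>k. (norm (x (Suc k) - p))\<^sup>2) \<longlonglongrightarrow> l"
    using key by (auto simp: convergent_def)
  have "(\<lambda>n. (norm (x (Suc (r (s n))) - p))\<^sup>2) \<longlonglongrightarrow> (norm (p - p))\<^sup>2"
    by (intro tendsto_intros p)
  from LIMSEQ_unique[OF filterlim_compose[OF l rs] this] have "l = 0" by simp
  then have "(\<lambda>k. sqrt ((norm (x (Suc k) - p))\<^sup>2)) \<longlonglongrightarrow> sqrt 0" 
    using tendsto_real_sqrt[OF l] by simp
  then have "(\<lambda>k. x (Suc k)) \<longlonglongrightarrow> p" 
    by (simp add: tendsto_norm_zero_iff LIM_zero_iff)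
  then have "x \<longlonglongrightarrow> p" by (rule LIMSEQ_imp_Suc)
  with pmin show ?thesis ..
qed

end
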